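(* Let $1\le k\le n$, let $f$ be a real-valued differentiable function on a neighborhood $\mathrm{St}_\delta(k,n)$ of $\mathrm{St}(k,n)$ with Euclidean gradient $\mathcal{H}(P)=\partial f(P)/\partial P$, and suppose that the NPDo Ansatz holds for $f$ with a subset $\mathbb{P}\subseteq\mathrm{St}(k,n)$. Let the sequence $\{P^{(i)}\}_{i=0}^\infty$ be generated by Algorithm NPDoSCF (described in the context) from some $P^{(0)}\in\mathbb{P}$, with the associated matrices $Q_i\in\mathrm{St}(k,k)$, and let $P_*$ be an accumulation point of the sequence $\{P^{(i)}\}_{i=0}^\infty$. Then: (a) $\mathcal{R}(P_* )$ is an accumulation point of the sequence $\{\mathcal{R}(P^{(i)})\}_{i=0}^\infty$. (b) Suppose that $\mathcal{R}(P_* )$ is an isolated accumulation point of $\{\mathcal{R}(P^{(i)})\}_{i=0}^\infty$. If $\mathrm{rank}(\mathcal{H}(P_*Q))=k$ for any $Q\in\mathrm{St}(k,k)$, then the entire sequence $\{\mathcal{R}(P^{(i)})\}_{i=0}^\infty$ converges to $\mathcal{R}(P_* )$. (c) Suppose that $P_*$ is an isolated accumulation point of $\{P^{(i)}\}_{i=0}^\infty$ and that $\mathrm{rank}(\mathcal{H}(P_* ))=k$. Then the entire sequence $\{P^{(i)}\}_{i=0}^\infty$ converges to $P_*$ if one of the following two assumptions holds: (c1) $Q_i$ converges to $I_k$ as $i\to\infty$; (c2) $f(P_* )>f(P)$ for any $P\in\mathrm{St}(k,n)$ with $P\ne P_*$ and $\mathcal{R}(P)=\mathcal{R}(P_* )$,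 i.e., $f$ has a unique maximizer, namely $P_*$, in the orbit $\{P_*Q: Q\in\mathrm{St}(k,k)\}$.
   Context: $\mathrm{St}(k,n)=\{P\in\mathbb{R}^{n\times k}: P^{\mathrm T}P=I_k\}$; $\mathrm{St}_\delta(k,n)=\{P\in\mathbb{R}^{n\times k}:\|P^{\mathrm T}P-I_k\|<\delta\}$ for some constant $\delta>0$ and some matrix norm. $\partial f(P)/\partial P$ is the $n\times k$ matrix of partial derivatives with all entries of $P$ treated as independent. $\mathcal{R}(B)$ is the column space of $B$. Convergence and accumulation points of $k$-dimensional subspaces of $\mathbb{R}^n$ are with respect to the metric $\mathrm{dist}_2(\mathcal{X},\mathcal{Y})=\|\sin\Theta(\mathcal{X},\mathcal{Y})\|_2=\max_i\sin\theta_i$, where for $\mathcal{X}=\mathcal{R}(X)$, $\mathcal{Y}=\mathcal{R}(Y)$, $X,Y\in\mathrm{St}(k,n)$, $\Theta(\mathcal{X},\mathcal{Y})$ is the diagonal matrix of the canonical angles $\theta_i=\arccos\sigma_i(X^{\mathrm T}Y)\in[0,\pi/2]$, $1\le i\le k$, with $\sigma_i(\cdot)$ denoting singular values. NPDo Ansatz (for $f$ with $\mathbb{P}$): there is a constant $\omega>0$ (independent of $P,\widehat P$) such that whenever $P\in\mathbb{P}$, $\widehat P\in\mathrm{St}(k,n)$ and $\eta\in\mathbb{R}$ satisfy $\mathrm{tr}(\widehat P^{\mathrm T}\mathcal{H}(P))\ge \mathrm{tr}(P^{\mathrm T}\mathcal{H}(P))+\eta$, there exists $Q\in\mathrm{St}(k,k)$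 such that $\widetilde P=\widehat PQ\in\mathbb{P}$ and $f(\widetilde P)\ge f(P)+\omega\eta$. Algorithm NPDoSCF: given $P^{(0)}\in\mathbb{P}$, for $i=0,1,2,\dots$ (run indefinitely): compute a thin SVD $\mathcal{H}(P^{(i)})=U_i\Sigma_iV_i^{\mathrm T}$ with $U_i\in\mathrm{St}(k,n)$, $V_i\in\mathrm{St}(k,k)$; set $\widehat P^{(i)}=U_iV_i^{\mathrm T}\in\mathrm{St}(k,n)$, an orthonormal polar factor of $\mathcal{H}(P^{(i)})$; take $Q_i\in\mathrm{St}(k,k)$ as supplied by the NPDo Ansatz for $P=P^{(i)}$, $\widehat P=\widehat P^{(i)}$ and $\eta=\eta_i:=\mathrm{tr}([\widehat P^{(i)}]^{\mathrm T}\mathcal{H}(P^{(i)}))-\mathrm{tr}([P^{(i)}]^{\mathrm T}\mathcal{H}(P^{(i)}))$, i.e. such that $P^{(i+1)}:=\widehat P^{(i)}Q_i\in\mathbb{P}$ and $f(P^{(i+1)})\ge f(P^{(i)})+\omega\eta_i$.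
   Formalization: Parts (b) and (c) additionally assume that the gradient H is continuous on St(k,n); with f merely differentiable they are false (k=1, n=2: H can vanish on the unit circle except at ±P_*, so polar factors are arbitrary and the iterates can alternate). *)

theory Defs
  imports "HOL-Analysis.Analysis"
begin

text \<open>An \<open>n \<times> k\<close> real matrix is an element of \<^typ>\<open>real^'k^'n\<close>. For \<^typ>\<open>real^'k^'k\<close> the Stiefel manifold
  consists of the orthogonal matrices.\<close>

definition stiefel :: "(real^'k^'n) set" where
  "stiefel = {P. transpose P ** P = mat 1}"

definition is_norm :: "('a::real_vector \<Rightarrow> real) \<Rightarrow> bool" where
  "is_norm N \<longleftrightarrow>
     (\<forall>x. N x = 0 \<longleftrightarrow> x = 0) \<and> (\<forall>c x. N (c *\<^sub>R x) = \<bar>c\<bar> * N x) \<and> (\<forall>x y. N (x + y) \<le> N x + N y)"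

definition stiefel_nhd :: "(real^'k^'k \<Rightarrow> real) \<Rightarrow> real \<Rightarrow> (real^'k^'n) set" where
  "stiefel_nhd N \<delta> = {P. N (transpose P ** P - mat 1) < \<delta>}"

text \<open>\<^term>\<open>axis i (axis j 1)\<close> is the matrix whose only nonzero entry is a 1 in row \<open>i\<close>, column \<open>j\<close>,
  so the entries below are the partial derivatives with all entries of \<open>P\<close> independent.\<close>

definition euclidean_gradient :: "(real^'k^'n \<Rightarrow> real) \<Rightarrow> real^'k^'n \<Rightarrow> real^'k^'n" where
  "euclidean_gradient f P = (\<chi> i j. deriv (\<lambda>t. f (P + t *\<^sub>R axis i (axis j 1))) 0)"

definition column_space :: "real^'k^'n \<Rightarrow> (real^'n) set" where
  "column_space B = span (columns B)"

definition singular_values :: "real^'k^'n \<Rightarrow> real set" where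
  "singular_values A =
     {s. s \<ge> 0 \<and> (\<exists>v. v \<noteq> 0 \<and> (transpose A ** A) *v v = s\<^sup>2 *\<^sub>R v)}"

text \<open>The index type \<open>'k\<close> carries no order, so the singular values on the diagonal of \<open>S\<close> are not
  required to be sorted. Sorting them permutes the columns of \<open>U\<close> and \<open>V\<close> simultaneously, which
  leaves the polar factor \<open>U ** transpose V\<close> unchanged.\<close>

definition thin_svd ::
    "real^'k^'n \<Rightarrow> real^'k^'n \<Rightarrow> real^'k^'k \<Rightarrow> real^'k^'k \<Rightarrow> bool" where
  "thin_svd A U S V \<longleftrightarrow>
     U \<in> stiefel \<and> V \<in> stiefel \<and>
     (\<forall>i j. i \<noteq> j \<longrightarrow> S $ i $ j = 0) \<and> (\<forall>i. S $ i $ i \<ge> 0) \<and>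
     A = U ** S ** transpose V"

text \<open>The argument \<^term>\<open>TYPE('k)\<close> fixes the dimension \<open>k = CARD('k)\<close> of the subspaces.\<close>

definition grassmannian :: "'k::finite itself \<Rightarrow> (real^'n) set set" where
  "grassmannian _ = {S. subspace S \<and> dim S = CARD('k)}"

definition orthonormal_basis_matrix :: "(real^'n) set \<Rightarrow> real^'k^'n" where
  "orthonormal_basis_matrix S = (SOME X. X \<in> stiefel \<and> column_space X = S)"

text \<open>The canonical angles do not depend on the chosen orthonormal bases. As only the largest sine
  matters, the set of the singular values (without multiplicities) suffices.\<close>

definition canonical_angles ::
    "'k::finite itself \<Rightarrow> (real^'n) set \<Rightarrow> (real^'n) set \<Rightarrow> real set" where
  "canonical_angles _ S T =
     (let X = orthonormal_basis_matrix S :: real^'k^'n;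
          Y = orthonormal_basis_matrix T :: real^'k^'n
      in arccos ` singular_values (transpose X ** Y))"

definition dist2 :: "'k::finite itself \<Rightarrow> (real^'n) set \<Rightarrow> (real^'n) set \<Rightarrow> real" where
  "dist2 k S T = Max (sin ` canonical_angles k S T)"

text \<open>Sequences in a set \<open>M\<close> with metric \<open>d\<close>; neither the subspaces nor their metric come as an
  instance of the class \<^class>\<open>metric_space\<close>.\<close>

definition converges_in :: "'a set \<Rightarrow> ('a \<Rightarrow> 'a \<Rightarrow> real) \<Rightarrow> (nat \<Rightarrow> 'a) \<Rightarrow> 'a \<Rightarrow> bool" where
  "converges_in M d x l \<longleftrightarrow> l \<in> M \<and> (\<lambda>i. d (x i) l) \<longlonglongrightarrow> 0"

definition accumulation_point_in ::
    "'a set \<Rightarrow> ('a \<Rightarrow> 'a \<Rightarrow> real) \<Rightarrow> (nat \<Rightarrow> 'a) \<Rightarrow> 'a \<Rightarrow> bool" where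
  "accumulation_point_in M d x l \<longleftrightarrow> (\<exists>r. strict_mono r \<and> converges_in M d (x \<circ> r) l)"

definition isolated_accumulation_point_in ::
    "'a set \<Rightarrow> ('a \<Rightarrow> 'a \<Rightarrow> real) \<Rightarrow> (nat \<Rightarrow> 'a) \<Rightarrow> 'a \<Rightarrow> bool" where
  "isolated_accumulation_point_in M d x l \<longleftrightarrow>
     accumulation_point_in M d x l \<and>
     (\<exists>\<epsilon>>0. \<forall>l'. accumulation_point_in M d x l' \<and> d l' l < \<epsilon> \<longrightarrow> l' = l)"

definition npdo_ansatz ::
    "(real^'k^'n \<Rightarrow> real) \<Rightarrow> (real^'k^'n) set \<Rightarrow> real \<Rightarrow> bool" where
  "npdo_ansatz f \<P> \<omega> \<longleftrightarrow>
     \<omega> > 0 \<and>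
     (\<forall>P\<in>\<P>. \<forall>Ph\<in>stiefel. \<forall>\<eta>.
        trace (transpose Ph ** euclidean_gradient f P)
          \<ge> trace (transpose P ** euclidean_gradient f P) + \<eta> \<longrightarrow>
        (\<exists>Q::real^'k^'k. Q \<in> stiefel \<and> Ph ** Q \<in> \<P> \<and> f (Ph ** Q) \<ge> f P + \<omega> * \<eta>))"

text \<open>The SVD (hence the polar factor when the gradient is rank deficient) and \<open>Q i\<close> are not
  unique, so the algorithm is a relation covering every possible run.\<close>

definition npdo_scf ::
    "(real^'k^'n \<Rightarrow> real) \<Rightarrow> (real^'k^'n) set \<Rightarrow> real \<Rightarrow>
     (nat \<Rightarrow> real^'k^'n) \<Rightarrow> (nat \<Rightarrow> real^'k^'k) \<Rightarrow> bool" where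
  "npdo_scf f \<P> \<omega> P Q \<longleftrightarrow>
     P 0 \<in> \<P> \<and>
     (\<forall>i. \<exists>U S V.
        let H = euclidean_gradient f (P i);
            Ph = U ** transpose V;
            \<eta> = trace (transpose Ph ** H) - trace (transpose (P i) ** H)
        in thin_svd H U S V \<and>
           Q i \<in> stiefel \<and>
           P (Suc i) = Ph ** Q i \<and>
           P (Suc i) \<in> \<P> \<and>
           f (P (Suc i)) \<ge> f (P i) + \<omega> * \<eta>)"

end

theory Submission
  imports Defs
begin

text \<open>
  In \<open>dist\<^sub>2(\<R>(X), \<R>(Y)) = \<parallel>Y - X X\<^sup>T Y\<parallel>\<^sub>2\<close> the right-hand side is continuous in \<open>X\<close>, so convergence of
  orthonormal matrices carries over to their column spaces.

  The polar factor \<open>U V\<^sup>T\<close> of \<open>H = U S V\<^sup>T\<close> maximizes \<open>tr(X\<^sup>T H)\<close> over the Stiefel manifold, uniquely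
  if \<open>rank H = k\<close>. Hence \<open>\<eta>\<^sub>i \<ge> 0\<close>, so \<open>f(P\<^sub>i)\<close> increases and converges by compactness, and \<open>\<eta>\<^sub>i \<rightarrow> 0\<close>. If
  \<open>P\<^sub>i \<rightarrow> X\<close> along a subsequence and \<open>\<H>(X)\<close> has full rank, then in the limit \<open>X\<close> attains the maximum
  for \<open>\<H>(X)\<close>, so it is the limit of the polar factors, and the next iterates accumulate at \<open>X R\<close> with
  \<open>R\<close> orthogonal. These have the column space of \<open>X\<close>; under (c1) or (c2) even \<open>X R = X\<close>. Thus one
  step from near the isolated accumulation point stays near it, and the sequence cannot leave.
\<close>

text \<open>Keeps adjoints in the form \<open>transpose A *v x\<close>, so that they compose with
  matrix products.\<close>

declare transpose_matrix_vector [simp del]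

section \<open>Limits, inner products and operator norms of matrices\<close>

lemma tendsto_matrix_mult:
  fixes A :: "'a \<Rightarrow> real^'m^'n" and B :: "'a \<Rightarrow> real^'k^'m"
  assumes "(A \<longlongrightarrow> a) F" and "(B \<longlongrightarrow> b) F"
  shows "((\<lambda>x. A x ** B x) \<longlongrightarrow> a ** b) F"
  unfolding matrix_matrix_mult_def by (intro tendsto_intros assms)

lemma tendsto_transpose:
  fixes A :: "'a \<Rightarrow> real^'m^'n"
  assumes "(A \<longlongrightarrow> a) F"
  shows "((\<lambda>x. transpose (A x)) \<longlongrightarrow> transpose a) F"
  unfolding transpose_def by (intro tendsto_intros assms)

lemma trace_transpose_mult_eq_inner:
  fixes A B :: "real^'k^'n"
  shows "trace (transpose A ** B) = inner A B"
  unfolding trace_def matrix_matrix_mult_def transpose_def inner_vec_def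
  by simp (rule sum.swap)

lemma inner_matrix_vector_mult:
  fixes A :: "real^'k^'n"
  shows "inner (A *v x) y = inner x (transpose A *v y)"
  by (metis dot_lmul_matrix inner_commute vector_transpose_matrix)

text \<open>By the triangle inequality the two norms differ by at most the norm of
  \<open>A x - a\<close>, and the sum of the absolute entries dominates that norm.\<close>

lemma tendsto_onorm_matrix:
  fixes A :: "'a \<Rightarrow> real^'k^'n"
  assumes "(A \<longlongrightarrow> a) F"
  shows "((\<lambda>x. onorm ((*v) (A x))) \<longlongrightarrow> onorm ((*v) a)) F"
proof -
  have triangle: "onorm ((*v) (A + B)) \<le> onorm ((*v) A) + onorm ((*v) B)" for A B :: "real^'k^'n"
  proof -
    have "(*v) (A + B) = (\<lambda>x. A *v x + B *v x)"
      by (simp add: fun_eq_iff matrix_vector_mult_add_rdistrib)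
    then show ?thesis
      by (simp add: onorm_triangle)
  qed
  define g where "g x = (\<Sum>i\<in>UNIV. \<Sum>j\<in>UNIV. \<bar>(A x - a) $ i $ j\<bar>)" for x
  have g: "onorm ((*v) (A x - a)) \<le> g x" "onorm ((*v) (a - A x)) \<le> g x" for x
    using onorm_le_matrix_component_sum[of "A x - a"] onorm_le_matrix_component_sum[of "a - A x"]
    by (auto simp: g_def abs_minus_commute)
  have "\<bar>onorm ((*v) (A x)) - onorm ((*v) a)\<bar> \<le> g x" for x
    using triangle[of "A x - a" a] triangle[of "a - A x" "A x"] g[of x]
    by simp
  moreover have "(g \<longlongrightarrow> (\<Sum>i\<in>UNIV. \<Sum>j\<in>UNIV. \<bar>(a - a) $ i $ j\<bar>)) F"
    unfolding g_def by (intro tendsto_intros assms)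
  then have "(g \<longlongrightarrow> 0) F" by simp
  ultimately have "((\<lambda>x. onorm ((*v) (A x)) - onorm ((*v) a)) \<longlongrightarrow> 0) F"
    using Lim_null_comparison[of "\<lambda>x. onorm ((*v) (A x)) - onorm ((*v) a)" g F]
    by (simp only: real_norm_def eventually_True)
  then show ?thesis by (simp add: LIM_zero_iff)
qed

subsection \<open>The Stiefel manifold\<close>

lemma stiefel_mult:
  fixes P :: "real^'k^'n" and R :: "real^'k^'k"
  assumes "P \<in> stiefel" and "R \<in> stiefel"
  shows "P ** R \<in> stiefel"
proof -
  have "transpose (P ** R) ** (P ** R) = transpose R ** ((transpose P ** P) ** R)"
    by (simp add: matrix_transpose_mul matrix_mul_assoc)
  then show ?thesis
    using assms by (simp add: stiefel_def)
qed

lemma stiefel_square_transpose: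
  fixes R :: "real^'k^'k"
  assumes "R \<in> stiefel"
  shows "R ** transpose R = mat 1" and "transpose R \<in> stiefel"
  using assms unfolding stiefel_def by (simp_all add: matrix_left_right_inverse)

lemma stiefel_vector:
  fixes P :: "real^'k^'n"
  assumes "P \<in> stiefel"
  shows "transpose P *v (P *v x) = x"
  using assms unfolding stiefel_def by (simp add: matrix_vector_mul_assoc)

lemma stiefel_inner:
  fixes P :: "real^'k^'n"
  assumes "P \<in> stiefel"
  shows "inner (P *v x) (P *v y) = inner x y"
  using assms by (simp add: inner_matrix_vector_mult stiefel_vector)

lemma stiefel_norm:
  fixes P :: "real^'k^'n"
  assumes "P \<in> stiefel"
  shows "norm (P *v x) = norm x"
  using assms by (simp add: norm_eq_sqrt_inner stiefel_inner)

lemma compact_stiefel: "compact (stiefel :: (real^'k^'n) set)"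
  unfolding compact_eq_bounded_closed
proof
  \<comment> \<open>The norm here is the Frobenius norm, whose square is the trace of
    \<open>transpose P ** P\<close>.\<close>
  have "norm P = sqrt (real CARD('k))" if "P \<in> stiefel" for P :: "real^'k^'n"
    using that trace_transpose_mult_eq_inner[of P P]
    by (simp add: stiefel_def norm_eq_sqrt_inner trace_I)
  then show "bounded (stiefel :: (real^'k^'n) set)"
    by (intro boundedI) auto
  show "closed (stiefel :: (real^'k^'n) set)"
    unfolding closed_sequential_limits
  proof safe
    fix X :: "nat \<Rightarrow> real^'k^'n" and L
    assume X: "\<forall>n. X n \<in> stiefel" and lim: "X \<longlonglongrightarrow> L"
    have "(\<lambda>i. transpose (X i) ** X i) \<longlonglongrightarrow> transpose L ** L"
      by (intro tendsto_matrix_mult tendsto_transpose lim)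
    moreover have "(\<lambda>i. transpose (X i) ** X i) = (\<lambda>i. mat 1)"
      using X by (auto simp: stiefel_def)
    ultimately show "L \<in> stiefel"
      by (simp add: stiefel_def LIMSEQ_const_iff)
  qed
qed

lemma column_space_eq_range:
  fixes P :: "real^'k^'n"
  shows "column_space P = range ((*v) P)"
proof
  show "range ((*v) P) \<subseteq> column_space P"
    by (auto simp: column_space_def matrix_vector_mult_in_columnspace)
  have "subspace (range ((*v) P))"
    by (simp add: linear_subspace_image)
  then show "column_space P \<subseteq> range ((*v) P)"
    unfolding column_space_def
    by (intro span_minimal) (auto simp: columns_image_basis)
qed

lemma rank_stiefel:
  fixes P :: "real^'k^'n"
  assumes "P \<in> stiefel"
  shows "rank P = CARD('k)"
  using assms unfolding full_rank_injective by (metis injI stiefel_vector)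

lemma column_space_in_grassmannian:
  fixes P :: "real^'k^'n"
  assumes "P \<in> stiefel"
  shows "column_space P \<in> grassmannian TYPE('k)"
  using rank_stiefel[OF assms] unfolding column_rank_def
  by (simp add: grassmannian_def column_space_def)

text \<open>With \<open>A = transpose X ** Y\<close>, the identity is
  \<open>transpose Y ** Y = transpose Y ** X ** A = transpose A ** A\<close>.\<close>

lemma projection_fixed_imp_stiefel:
  fixes X Y :: "real^'k^'n"
  assumes "Y \<in> stiefel" and "Y = X ** (transpose X ** Y)"
  shows "transpose X ** Y \<in> stiefel"
proof -
  have "mat 1 = transpose Y ** (X ** (transpose X ** Y))"
    using assms by (simp add: stiefel_def)
  then show ?thesis
    by (simp add: stiefel_def matrix_transpose_mul matrix_mul_assoc)
qed

text \<open>\<open>X ** transpose X\<close> fixes every vector of the column space of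
  \<open>X\<close>. Hence two orthonormal bases of one subspace differ by an orthogonal
  factor.\<close>

lemma column_space_subset_imp_eq_mult:
  fixes X Y :: "real^'k^'n"
  assumes X: "X \<in> stiefel" and Y: "Y \<in> stiefel" and sub: "column_space Y \<subseteq> column_space X"
  shows "Y = X ** (transpose X ** Y)" and "transpose X ** Y \<in> stiefel"
proof -
  have "Y *v v = (X ** (transpose X ** Y)) *v v" for v
  proof -
    obtain w where "Y *v v = X *v w"
      using sub unfolding column_space_eq_range by blast
    then show ?thesis
      by (simp add: matrix_vector_mul_assoc[symmetric] stiefel_vector[OF X])
  qed
  then show *: "Y = X ** (transpose X ** Y)"
    by (simp add: matrix_eq)
  show "transpose X ** Y \<in> stiefel"
    by (rule projection_fixed_imp_stiefel[OF Y *])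
qed

lemma column_space_mult:
  fixes P :: "real^'k^'n" and R :: "real^'k^'k"
  assumes "R \<in> stiefel"
  shows "column_space (P ** R) = column_space P"
proof -
  have "P *v v = (P ** R) *v (transpose R *v v)" for v
    by (simp add: matrix_vector_mul_assoc matrix_mul_assoc[symmetric]
        stiefel_square_transpose[OF assms])
  then show ?thesis
    unfolding column_space_eq_range
    by (auto simp: matrix_vector_mul_assoc[symmetric])
qed

lemma orthonormal_basis_matrix_column_space:
  fixes P :: "real^'k^'n"
  assumes "P \<in> stiefel"
  shows "(orthonormal_basis_matrix (column_space P) :: real^'k^'n) \<in> stiefel"
    and "column_space (orthonormal_basis_matrix (column_space P) :: real^'k^'n) = column_space P"
proof -
  have "(orthonormal_basis_matrix (column_space P) :: real^'k^'n) \<in> stiefel \<and>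
    column_space (orthonormal_basis_matrix (column_space P) :: real^'k^'n) = column_space P"
    unfolding orthonormal_basis_matrix_def by (rule someI) (use assms in auto)
  then show "(orthonormal_basis_matrix (column_space P) :: real^'k^'n) \<in> stiefel"
    "column_space (orthonormal_basis_matrix (column_space P) :: real^'k^'n) = column_space P"
    by auto
qed

subsection \<open>Canonical angles\<close>

text \<open>Distinct eigenvalues have orthogonal eigenvectors, so there are only finitely many of them.\<close>

lemma finite_singular_values:
  fixes A :: "real^'k^'n"
  shows "finite (singular_values A)"
proof -
  let ?M = "transpose A ** A"
  have "\<forall>s\<in>singular_values A. \<exists>v. v \<noteq> 0 \<and> ?M *v v = s\<^sup>2 *\<^sub>R v"
    by (auto simp: singular_values_def)
  then obtain v where v: "\<And>s. s \<in> singular_values A \<Longrightarrow> v s \<noteq> 0 \<and> ?M *v v s = s\<^sup>2 *\<^sub>R v s"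
    by metis
  have orth: "inner (v s) (v t) = 0"
    if "s \<in> singular_values A" "t \<in> singular_values A" "s \<noteq> t" for s t
  proof -
    have "inner (?M *v v s) (v t) = inner (v s) (?M *v v t)"
      by (simp add: inner_matrix_vector_mult matrix_transpose_mul)
    then have "s\<^sup>2 * inner (v s) (v t) = t\<^sup>2 * inner (v s) (v t)"
      using v that by simp
    moreover have "s\<^sup>2 \<noteq> t\<^sup>2"
      using that by (auto simp: singular_values_def power2_eq_iff_nonneg)
    ultimately show ?thesis by simp
  qed
  have inj: "inj_on v (singular_values A)"
    using orth v by (metis inj_onI inner_eq_zero_iff)
  have "pairwise orthogonal (v ` singular_values A)"
    using orth by (auto simp: pairwise_def orthogonal_def)
  then have "independent (v ` singular_values A)"
    using v by (intro pairwise_orthogonal_independent) auto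
  then show ?thesis
    using inj finite_imageD independent_imp_finite by blast
qed

text \<open>Compactness of the unit sphere yields a maximizer, and homogeneity extends its bound to
  all vectors.\<close>

lemma onorm_attained:
  fixes A :: "real^'k^'n"
  obtains v where "norm v = 1" and "norm (A *v v) = onorm ((*v) A)"
proof -
  have "axis undefined 1 \<in> sphere (0::real^'k) 1"
    by simp
  then obtain v where v: "v \<in> sphere (0::real^'k) 1"
    and max: "\<And>w. w \<in> sphere 0 1 \<Longrightarrow> norm (A *v w) \<le> norm (A *v v)"
    using continuous_attains_sup[of "sphere (0::real^'k) 1" "\<lambda>v. norm (A *v v)"]
    by (metis compact_sphere continuous_on_norm empty_iff linear_continuous_on
        matrix_vector_mul_bounded_linear)
  have "norm (A *v w) \<le> norm (A *v v) * norm w" for w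
  proof (cases "w = 0")
    case False
    then have "norm (A *v (w /\<^sub>R norm w)) \<le> norm (A *v v)"
      by (intro max) simp
    then show ?thesis
      using False by (simp add: matrix_vector_mult_scaleR field_simps)
  qed simp
  then have "onorm ((*v) A) \<le> norm (A *v v)"
    by (rule onorm_le)
  moreover have "norm (A *v v) \<le> onorm ((*v) A)"
    using onorm[of "(*v) A" v] v by simp
  ultimately show ?thesis
    using that[of v] v by simp
qed

text \<open>Moving from \<open>v\<close> against \<open>u = q v\<close> changes the form by a
  negative first-order term, which a small step does not let the quadratic term compensate. This
  stands in for the spectral theorem when an extremal vector is to be an eigenvector.\<close>

lemma psd_form_zero:
  fixes q :: "'a::real_inner \<Rightarrow> 'a"
  assumes "linear q" and sym: "\<And>x y. inner x (q y) = inner (q x) y"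
    and nonneg: "\<And>x. inner x (q x) \<ge> 0" and zero: "inner v (q v) = 0"
  shows "q v = 0"
proof (rule ccontr)
  assume "q v \<noteq> 0"
  define u a c where "u = q v" and "a = inner u u" and "c = inner u (q u)"
  have a: "a > 0" using \<open>q v \<noteq> 0\<close> by (simp add: a_def u_def)
  have c: "c \<ge> 0" using nonneg by (simp add: c_def)
  \<comment> \<open>Adding 1 avoids division by zero when \<open>c = 0\<close>; the form is then at
    most \<open>- (a * a) / (c + 1)\<close>.\<close>
  define t where "t = - a / (c + 1)"
  have "q (v + t *\<^sub>R u) = u + t *\<^sub>R q u"
    using \<open>linear q\<close> by (simp add: linear_add linear_scale u_def)
  moreover have "inner v (q u) = a" "inner v u = 0"
    using sym[of v u] zero by (auto simp: a_def u_def)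
  ultimately have "inner (v + t *\<^sub>R u) (q (v + t *\<^sub>R u)) = 2 * t * a + t * t * c"
    by (simp add: inner_simps a_def c_def algebra_simps)
  also have "\<dots> \<le> 2 * t * a + t * (t * (c + 1))"
    by (simp add: algebra_simps)
  also have "t * (c + 1) = - a"
    using c by (simp add: t_def)
  also have "2 * t * a + t * - a = - (a * a) / (c + 1)"
    by (simp add: t_def)
  also have "\<dots> < 0"
    using a c by (intro divide_neg_pos) auto
  finally show False using nonneg[of "v + t *\<^sub>R u"] by simp
qed

text \<open>The bilinear form of \<open>B\<close> complements that of \<open>A\<close>: an eigenvector of \<open>A\<^sup>T A\<close> for
  \<open>cos\<^sup>2 \<theta>\<close> is one of \<open>B\<^sup>T B\<close> for \<open>sin\<^sup>2 \<theta>\<close>.\<close>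

lemma inner_projection_residual:
  fixes X Y :: "real^'k^'n"
  assumes X: "X \<in> stiefel" and Y: "Y \<in> stiefel"
  defines "A \<equiv> transpose X ** Y"
  defines "B \<equiv> Y - X ** A"
  shows "inner (B *v v) (B *v w) = inner v w - inner (A *v v) (A *v w)"
proof -
  have B: "B *v x = Y *v x - X *v (A *v x)" for x
    by (simp add: B_def matrix_vector_mult_diff_rdistrib matrix_vector_mul_assoc)
  have "inner (Y *v x) (X *v y) = inner (A *v x) y" for x y
    by (metis A_def inner_commute inner_matrix_vector_mult matrix_vector_mul_assoc)
  moreover from this have "inner (X *v y) (Y *v x) = inner y (A *v x)" for x y
    by (metis inner_commute)
  ultimately show ?thesis
    by (simp add: B inner_diff_left inner_diff_right stiefel_inner[OF X] stiefel_inner[OF Y])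
qed

text \<open>A singular vector of \<open>A\<close> for \<open>s\<close> is stretched by the residual
  \<open>B\<close> by the factor \<open>sin (arccos s)\<close>, which bounds every sine by the norm.
  Conversely, a unit vector maximizing the norm of \<open>B *v w\<close> is a singular vector of
  \<open>A\<close>, so the bound is attained.\<close>

lemma Max_sin_canonical_angles:
  fixes X Y :: "real^'k^'n"
  assumes X: "X \<in> stiefel" and Y: "Y \<in> stiefel"
  shows "Max (sin ` arccos ` singular_values (transpose X ** Y))
    = onorm ((*v) (Y - X ** (transpose X ** Y)))"
proof (rule Max_eqI)
  define A where "A = transpose X ** Y"
  define B where "B = Y - X ** A"
  note AB = inner_projection_residual[OF X Y, folded A_def, folded B_def]
  have sin_eq: "sin (arccos s) = sqrt (1 - s\<^sup>2)" if "0 \<le> s" "s\<^sup>2 \<le> 1" for s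
    using that power2_le_imp_le[of s 1] by (simp add: sin_arccos)
  have gram: "inner w ((transpose A ** A) *v v) = inner (A *v w) (A *v v)" for w v
    by (simp add: inner_matrix_vector_mult matrix_vector_mul_assoc)
  show "finite (sin ` arccos ` singular_values (transpose X ** Y))"
    by (simp add: finite_singular_values)
  show "y \<le> onorm ((*v) (Y - X ** (transpose X ** Y)))"
    if "y \<in> sin ` arccos ` singular_values (transpose X ** Y)" for y
  proof -
    obtain s v where s: "y = sin (arccos s)" "s \<ge> 0"
      and v: "v \<noteq> 0" "(transpose A ** A) *v v = s\<^sup>2 *\<^sub>R v"
      using \<open>y \<in> _\<close> by (auto simp: singular_values_def A_def)
    have "(norm (B *v v))\<^sup>2 = (1 - s\<^sup>2) * (norm v)\<^sup>2"
      using AB[of v v] gram[of v v] v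
      by (simp add: power2_norm_eq_inner algebra_simps)
    \<comment> \<open>A squared norm is nonnegative and \<open>v\<close> is nonzero; thus
      \<open>s\<close> lies where \<open>arccos\<close> inverts the cosine.\<close>
    moreover from this have "s\<^sup>2 \<le> 1"
      using v zero_le_power2[of "norm (B *v v)"] by (simp add: zero_le_mult_iff)
    ultimately have "norm (B *v v) = y * norm v"
      using s sin_eq[of s] by (metis abs_norm_cancel real_sqrt_abs real_sqrt_mult)
    then have "y * norm v \<le> onorm ((*v) B) * norm v"
      using onorm[of "(*v) B" v] by simp
    then show ?thesis using v by (simp add: B_def A_def)
  qed
  obtain v where v: "norm v = 1" "norm (B *v v) = onorm ((*v) B)"
    by (rule onorm_attained)
  define b where "b = onorm ((*v) B)"
  have b0: "b \<ge> 0" by (simp add: b_def onorm_pos_le)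
  have Bw: "inner (B *v w) (B *v w) \<le> b\<^sup>2 * inner w w" for w
    using onorm[of "(*v) B" w] unfolding b_def power2_norm_eq_inner[symmetric]
    by (metis norm_ge_zero power_mono power_mult_distrib matrix_vector_mul_bounded_linear)
  have Bv: "inner (B *v v) (B *v v) = b\<^sup>2" "inner v v = 1"
    using v unfolding b_def by (metis power2_norm_eq_inner one_power2)+
  \<comment> \<open>The form of \<open>q\<close> at \<open>w\<close> equals
    \<open>b\<^sup>2 * inner w w - inner (B *v w) (B *v w)\<close>: nonnegative because
    \<open>b\<close> is the operator norm, and zero at the maximizer \<open>v\<close>.\<close>
  define q where "q w = (transpose A ** A) *v w - (1 - b\<^sup>2) *\<^sub>R w" for w
  have "q v = 0"
  proof (rule psd_form_zero[of q])
    show "linear q"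
      by (rule linearI) (simp_all add: q_def matrix_vector_right_distrib matrix_vector_mult_scaleR algebra_simps)
    have q: "inner w (q u) = inner (A *v w) (A *v u) - (1 - b\<^sup>2) * inner w u" for w u
      using gram[of w u] by (simp add: q_def inner_diff_right)
    show "inner w (q u) = inner (q w) u" for w u
      using q[of w u] q[of u w] by (simp add: inner_commute)
    show "inner w (q w) \<ge> 0" for w
      using q[of w w] AB[of w w] Bw[of w] by (simp add: algebra_simps)
    show "inner v (q v) = 0"
      using q[of v v] AB[of v v] Bv by simp
  qed
  moreover have "1 - b\<^sup>2 = inner (A *v v) (A *v v)"
    using AB[of v v] Bv by simp
  then have b1: "b\<^sup>2 \<le> 1"
    using inner_ge_zero[of "A *v v"] by linarith
  ultimately have "sqrt (1 - b\<^sup>2) \<in> singular_values A"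
    using v unfolding singular_values_def by (auto simp: q_def intro!: exI[of _ v])
  moreover have "sin (arccos (sqrt (1 - b\<^sup>2))) = b"
    using b0 b1 by (subst sin_eq) auto
  ultimately show "onorm ((*v) (Y - X ** (transpose X ** Y)))
      \<in> sin ` arccos ` singular_values (transpose X ** Y)"
    unfolding A_def[symmetric] B_def[symmetric] b_def[symmetric] by force
qed

lemma onorm_mult_orthogonal_right:
  fixes B :: "real^'k^'n" and R :: "real^'k^'k"
  assumes "R \<in> stiefel"
  shows "onorm ((*v) (B ** R)) = onorm ((*v) B)"
proof -
  have le: "onorm ((*v) (B ** R)) \<le> onorm ((*v) B)"
    if "R \<in> stiefel" for B :: "real^'k^'n" and R :: "real^'k^'k"
  proof (rule onorm_le)
    fix x
    show "norm ((B ** R) *v x) \<le> onorm ((*v) B) * norm x"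
      using onorm[of "(*v) B" "R *v x"] stiefel_norm[OF that]
      by (simp add: matrix_vector_mul_assoc[symmetric])
  qed
  have "(B ** R) ** transpose R = B"
    by (simp add: matrix_mul_assoc[symmetric] stiefel_square_transpose[OF assms])
  then show ?thesis
    using le[OF assms, of B] le[OF stiefel_square_transpose(2)[OF assms], of "B ** R"] by simp
qed

text \<open>The bases picked by the definition are \<open>X ** R\<close> and \<open>Y ** S\<close>
  with orthogonal factors. \<open>R\<close> cancels in the projection, and \<open>S\<close> only
  multiplies the residual from the right, which preserves its norm.\<close>

lemma dist2_column_space:
  fixes X Y :: "real^'k^'n"
  assumes X: "X \<in> stiefel" and Y: "Y \<in> stiefel"
  shows "dist2 TYPE('k) (column_space X) (column_space Y) =
    onorm ((*v) (Y - X ** (transpose X ** Y)))"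
proof -
  define X' :: "real^'k^'n" where "X' = orthonormal_basis_matrix (column_space X)"
  define Y' :: "real^'k^'n" where "Y' = orthonormal_basis_matrix (column_space Y)"
  have X': "X' \<in> stiefel" "column_space X' = column_space X"
    and Y': "Y' \<in> stiefel" "column_space Y' = column_space Y"
    unfolding X'_def Y'_def
    using orthonormal_basis_matrix_column_space[OF X] orthonormal_basis_matrix_column_space[OF Y]
    by auto
  obtain R where R: "R \<in> stiefel" "X' = X ** R"
    using column_space_subset_imp_eq_mult[OF X X'(1)] X'(2) by auto
  obtain S where S: "S \<in> stiefel" "Y' = Y ** S"
    using column_space_subset_imp_eq_mult[OF Y Y'(1)] Y'(2) by auto
  have "X' ** transpose X' = X ** ((R ** transpose R) ** transpose X)"
    unfolding R matrix_transpose_mul by (simp add: matrix_mul_assoc)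
  then have proj: "X' ** transpose X' = X ** transpose X"
    by (simp add: stiefel_square_transpose[OF R(1)])
  have "Y' - X' ** (transpose X' ** Y') = (Y - X ** (transpose X ** Y)) ** S"
    unfolding matrix_mul_assoc proj S
    by (simp add: matrix_eq matrix_vector_mult_diff_rdistrib matrix_vector_mul_assoc[symmetric])
  then show ?thesis
    unfolding dist2_def canonical_angles_def Let_def X'_def[symmetric] Y'_def[symmetric]
    by (simp add: Max_sin_canonical_angles X'(1) Y'(1) onorm_mult_orthogonal_right S(1))
qed

lemma dist2_nonneg:
  fixes X Y :: "real^'k^'n"
  assumes "X \<in> stiefel" and "Y \<in> stiefel"
  shows "dist2 TYPE('k) (column_space X) (column_space Y) \<ge> 0"
  by (simp add: dist2_column_space[OF assms] onorm_pos_le)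

lemma dist2_eq_0_iff:
  fixes X Y :: "real^'k^'n"
  assumes X: "X \<in> stiefel" and Y: "Y \<in> stiefel"
  shows "dist2 TYPE('k) (column_space X) (column_space Y) = 0 \<longleftrightarrow> column_space X = column_space Y"
proof -
  have "dist2 TYPE('k) (column_space X) (column_space Y) = 0 \<longleftrightarrow> Y = X ** (transpose X ** Y)"
    by (auto simp: dist2_column_space[OF X Y] onorm_eq_0 matrix_eq
        matrix_vector_mult_diff_rdistrib)
  also have "\<dots> \<longleftrightarrow> column_space X = column_space Y"
  proof
    assume eq: "Y = X ** (transpose X ** Y)"
    show "column_space X = column_space Y"
      using column_space_mult[OF projection_fixed_imp_stiefel[OF Y eq], of X] eq by simp
  next
    assume "column_space X = column_space Y"
    then show "Y = X ** (transpose X ** Y)"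
      using column_space_subset_imp_eq_mult(1)[OF X Y] by simp
  qed
  finally show ?thesis .
qed

lemma tendsto_dist2:
  fixes X :: "nat \<Rightarrow> real^'k^'n" and Y :: "real^'k^'n"
  assumes "\<And>i. X i \<in> stiefel" and "L \<in> stiefel" and "Y \<in> stiefel" and "X \<longlonglongrightarrow> L"
  shows "(\<lambda>i. dist2 TYPE('k) (column_space (X i)) (column_space Y))
    \<longlonglongrightarrow> dist2 TYPE('k) (column_space L) (column_space Y)"
  unfolding dist2_column_space[OF assms(1,3)] dist2_column_space[OF assms(2,3)]
  by (intro tendsto_onorm_matrix tendsto_matrix_mult tendsto_transpose tendsto_intros assms(4))

lemma converges_in_column_space:
  fixes X :: "nat \<Rightarrow> real^'k^'n"
  assumes "\<And>i. X i \<in> stiefel" and "L \<in> stiefel" and "X \<longlonglongrightarrow> L"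
  shows "converges_in (grassmannian TYPE('k)) (dist2 TYPE('k)) (\<lambda>i. column_space (X i)) (column_space L)"
  using tendsto_dist2[OF assms(1,2,2,3)] dist2_eq_0_iff[of L L] assms(2)
  by (simp add: converges_in_def column_space_in_grassmannian)

subsection \<open>Polar factors\<close>

lemma compact_subseqE:
  fixes x :: "nat \<Rightarrow> 'a::metric_space"
  assumes "compact K" and "\<And>i. x i \<in> K"
  obtains l r where "l \<in> K" and "strict_mono (r :: nat \<Rightarrow> nat)" and "(x \<circ> r) \<longlonglongrightarrow> l"
  using seq_compactE[OF compact_imp_seq_compact[OF assms(1)], of x] assms(2) by blast

text \<open>Cyclicity of the trace moves \<open>V\<close> over to \<open>X\<close>, and the diagonal
  \<open>S\<close> scales the columns of \<open>U\<close>.\<close>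

lemma inner_svd:
  fixes X U :: "real^'k^'n" and S V :: "real^'k^'k"
  assumes diag: "\<And>i j. i \<noteq> j \<Longrightarrow> S $ i $ j = 0"
  shows "inner X (U ** S ** transpose V) = (\<Sum>i\<in>UNIV. S $ i $ i * inner (column i (X ** V)) (column i U))"
proof -
  have "inner X (U ** S ** transpose V) = trace (transpose X ** U ** S ** transpose V)"
    by (simp add: trace_transpose_mult_eq_inner[symmetric] matrix_mul_assoc)
  also have "\<dots> = trace (transpose V ** (transpose X ** U ** S))"
    by (rule trace_mul_sym)
  also have "\<dots> = trace (transpose (X ** V) ** (U ** S))"
    by (simp add: matrix_transpose_mul matrix_mul_assoc)
  also have "\<dots> = (\<Sum>i\<in>UNIV. inner (column i (X ** V)) (column i (U ** S)))"
    unfolding trace_def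
    by (simp add: matrix_matrix_mult_def transpose_def column_def inner_vec_def)
  also have "\<dots> = (\<Sum>i\<in>UNIV. S $ i $ i * inner (column i (X ** V)) (column i U))"
  proof (rule sum.cong)
    fix i
    have "(U ** S) $ a $ i = U $ a $ i * S $ i $ i" for a
    proof -
      have "(U ** S) $ a $ i = (\<Sum>c\<in>UNIV. if c = i then U $ a $ i * S $ i $ i else 0)"
        unfolding matrix_matrix_mult_def vec_lambda_beta
        by (rule sum.cong) (auto simp: diag)
      then show ?thesis by simp
    qed
    then have "column i (U ** S) = S $ i $ i *\<^sub>R column i U"
      by (simp add: column_def vec_eq_iff)
    then show "inner (column i (X ** V)) (column i (U ** S))
        = S $ i $ i * inner (column i (X ** V)) (column i U)"
      by simp
  qed simp
  finally show ?thesis .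
qed

lemma norm_column_stiefel:
  fixes P :: "real^'k^'n"
  assumes "P \<in> stiefel"
  shows "norm (column i P) = 1"
  using stiefel_norm[OF assms, of "axis i 1"] by (simp add: matrix_vector_mult_basis)

text \<open>With unit columns \<open>x\<close> of \<open>X V\<close> and \<open>u\<close> of \<open>U\<close> the gap between the two traces is a sum of
  terms \<open>S\<^sub>i\<^sub>i (1 - x \<bullet> u) = S\<^sub>i\<^sub>i \<parallel>x - u\<parallel>\<^sup>2 / 2\<close>.\<close>

lemma inner_polar_factor_gap:
  fixes H X U :: "real^'k^'n" and S V :: "real^'k^'k"
  assumes svd: "thin_svd H U S V" and X: "X \<in> stiefel"
  shows "inner (U ** transpose V) H - inner X H
    = (\<Sum>i\<in>UNIV. S $ i $ i * ((norm (column i (X ** V) - column i U))\<^sup>2 / 2))"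
proof -
  have U: "U \<in> stiefel" and V: "V \<in> stiefel" and diag: "\<And>i j. i \<noteq> j \<Longrightarrow> S $ i $ j = 0"
    and H: "H = U ** S ** transpose V"
    using svd by (auto simp: thin_svd_def)
  have "U ** transpose V ** V = U"
    using V by (simp add: matrix_mul_assoc[symmetric] stiefel_def)
  then have "inner (U ** transpose V) H - inner X H
    = (\<Sum>i\<in>UNIV. S $ i $ i * (inner (column i U) (column i U) - inner (column i (X ** V)) (column i U)))"
    unfolding H by (simp add: inner_svd[OF diag] sum_subtractf algebra_simps)
  also have "\<dots> = (\<Sum>i\<in>UNIV. S $ i $ i * ((norm (column i (X ** V) - column i U))\<^sup>2 / 2))"
  proof (intro sum.cong arg_cong2[where f = "(*)"] refl)
    fix i
    have "inner (column i U) (column i U) = 1" "inner (column i (X ** V)) (column i (X ** V)) = 1"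
      using norm_column_stiefel[OF U, of i] norm_column_stiefel[OF stiefel_mult[OF X V], of i]
      by (simp_all add: norm_eq_1)
    then show "inner (column i U) (column i U) - inner (column i (X ** V)) (column i U)
        = (norm (column i (X ** V) - column i U))\<^sup>2 / 2"
      by (simp add: power2_norm_eq_inner inner_diff_left inner_diff_right inner_commute)
  qed
  finally show ?thesis .
qed

lemma inner_le_polar_factor:
  fixes H X U :: "real^'k^'n" and S V :: "real^'k^'k"
  assumes "thin_svd H U S V" and "X \<in> stiefel"
  shows "inner X H \<le> inner (U ** transpose V) H"
proof -
  have "0 \<le> inner (U ** transpose V) H - inner X H"
    unfolding inner_polar_factor_gap[OF assms]
    using assms(1) by (intro sum_nonneg) (simp add: thin_svd_def)
  then show ?thesis by simp
qed

text \<open>Full rank makes every weight \<open>S $ i $ i\<close> positive, so a vanishing gap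
  forces the columns of \<open>X ** V\<close> and \<open>U\<close> to agree.\<close>

lemma polar_factor_unique_maximizer:
  fixes H X U :: "real^'k^'n" and S V :: "real^'k^'k"
  assumes svd: "thin_svd H U S V" and X: "X \<in> stiefel" and rank: "rank H = CARD('k)"
    and eq: "inner X H = inner (U ** transpose V) H"
  shows "X = U ** transpose V"
proof -
  have V: "V \<in> stiefel" and S0: "\<And>i. S $ i $ i \<ge> 0" and diag: "\<And>i j. i \<noteq> j \<Longrightarrow> S $ i $ j = 0"
    and H: "H = U ** S ** transpose V"
    using svd by (auto simp: thin_svd_def)
  \<comment> \<open>A zero entry would put the nonzero vector \<open>V *v axis i 1\<close> into the
    kernel of \<open>H\<close>.\<close>
  have pos: "S $ i $ i > 0" for i
  proof (rule ccontr)
    assume "\<not> S $ i $ i > 0"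
    then have "S $ i $ i = 0" using S0[of i] by simp
    then have "S $ j $ i = 0" for j by (metis diag)
    then have "S *v axis i 1 = 0"
      by (simp add: matrix_vector_mult_basis column_def vec_eq_iff)
    then have "H *v (V *v axis i 1) = 0"
      by (simp add: H matrix_vector_mul_assoc[symmetric] stiefel_vector[OF V])
    moreover have "V *v axis i 1 \<noteq> 0"
      using stiefel_norm[OF V, of "axis i 1"] by auto
    moreover have "inj ((*v) H)"
      using rank by (simp add: full_rank_injective)
    ultimately show False
      by (metis injD matrix_vector_mult_0_right)
  qed
  have "(\<Sum>i\<in>UNIV. S $ i $ i * ((norm (column i (X ** V) - column i U))\<^sup>2 / 2)) = 0"
    using inner_polar_factor_gap[OF svd X] eq by simp
  then have "\<forall>i\<in>UNIV. S $ i $ i * ((norm (column i (X ** V) - column i U))\<^sup>2 / 2) = 0"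
    using S0 by (subst (asm) sum_nonneg_eq_0_iff) auto
  then have "column i (X ** V) = column i U" for i
    using pos[of i] by (auto simp: less_le)
  then have "X ** V = U"
    by (simp add: column_def vec_eq_iff)
  then have "U ** transpose V = X ** (V ** transpose V)"
    by (simp add: matrix_mul_assoc)
  then show ?thesis
    by (simp add: stiefel_square_transpose[OF V])
qed

text \<open>The diagonal factor is recovered as \<open>transpose U ** H ** V\<close>, so it
  converges along with the others, and the defining conditions are closed.\<close>

lemma thin_svd_limit:
  fixes H U :: "nat \<Rightarrow> real^'k^'n" and S V :: "nat \<Rightarrow> real^'k^'k"
  assumes svd: "\<And>i. thin_svd (H i) (U i) (S i) (V i)"
    and H: "H \<longlonglongrightarrow> H'" and U: "U \<longlonglongrightarrow> U'" and V: "V \<longlonglongrightarrow> V'"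
  shows "\<exists>S'. thin_svd H' U' S' V'"
proof -
  define S' where "S' = transpose U' ** H' ** V'"
  have UV: "U i \<in> stiefel" "V i \<in> stiefel" for i
    using svd by (auto simp: thin_svd_def)
  have UV': "U' \<in> stiefel" "V' \<in> stiefel"
    using UV U V compact_imp_closed[OF compact_stiefel] closed_sequentially by metis+
  have "S i = transpose (U i) ** H i ** V i" for i
  proof -
    have "transpose (U i) ** H i ** V i = (transpose (U i) ** U i) ** S i ** (transpose (V i) ** V i)"
      using svd[of i] by (simp add: thin_svd_def matrix_mul_assoc)
    then show ?thesis using UV by (simp add: stiefel_def)
  qed
  then have S: "S \<longlonglongrightarrow> S'"
    unfolding S'_def
    using tendsto_matrix_mult[OF tendsto_matrix_mult[OF tendsto_transpose[OF U] H] V] by presburger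
  have entry: "(\<lambda>n. S n $ i $ j) \<longlonglongrightarrow> S' $ i $ j" for i j
    by (intro tendsto_vec_nth S)
  have "S' $ i $ j = 0" if "i \<noteq> j" for i j
    using entry[of i j] svd that by (simp add: thin_svd_def LIMSEQ_const_iff)
  moreover have "S' $ i $ i \<ge> 0" for i
    using entry[of i i] svd by (intro LIMSEQ_le_const[OF entry[of i i]]) (auto simp: thin_svd_def)
  moreover have H_eq: "(\<lambda>i. U i ** S i ** transpose (V i)) = H"
    using svd by (auto simp: thin_svd_def fun_eq_iff)
  have "(\<lambda>i. U i ** S i ** transpose (V i)) \<longlonglongrightarrow> U' ** S' ** transpose V'"
    by (intro tendsto_matrix_mult tendsto_transpose U S V)
  then have "H' = U' ** S' ** transpose V'"
    unfolding H_eq using H LIMSEQ_unique by blast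
  ultimately show ?thesis
    using UV' unfolding thin_svd_def by blast
qed

text \<open>The gap \<open>\<langle>U V\<^sup>T - P, H\<rangle>\<close> is \<open>\<eta>\<close> in the algorithm.\<close>

lemma polar_factors_converge:
  fixes H P U :: "nat \<Rightarrow> real^'k^'n" and S V :: "nat \<Rightarrow> real^'k^'k"
  assumes svd: "\<And>i. thin_svd (H i) (U i) (S i) (V i)" and P: "\<And>i. P i \<in> stiefel"
    and H_lim: "H \<longlonglongrightarrow> H'" and P_lim: "P \<longlonglongrightarrow> P'" and rank: "rank H' = CARD('k)"
    and gap: "(\<lambda>i. inner (U i ** transpose (V i)) (H i) - inner (P i) (H i)) \<longlonglongrightarrow> 0"
  shows "\<exists>r. strict_mono r \<and> (\<lambda>i. U (r i) ** transpose (V (r i))) \<longlonglongrightarrow> P'"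
proof -
  have UV_in: "(U i, V i) \<in> stiefel \<times> stiefel" for i
    using svd[of i] by (simp add: thin_svd_def)
  \<comment> \<open>The factors of an SVD are not unique and may oscillate, hence the passage to a
    subsequence.\<close>
  obtain W and r :: "nat \<Rightarrow> nat" where "W \<in> stiefel \<times> stiefel" and r: "strict_mono r"
      and W: "((\<lambda>i. (U i, V i)) \<circ> r) \<longlonglongrightarrow> W"
    by (rule compact_subseqE[OF compact_Times[OF compact_stiefel compact_stiefel] UV_in])
  obtain U' V' where "W = (U', V')" by (cases W)
  with W have U: "(U \<circ> r) \<longlonglongrightarrow> U'" and V: "(V \<circ> r) \<longlonglongrightarrow> V'"
    using tendsto_fst[OF W] tendsto_snd[OF W] by (simp_all add: o_def)
  have Hr: "(H \<circ> r) \<longlonglongrightarrow> H'" and Pr: "(P \<circ> r) \<longlonglongrightarrow> P'"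
    using H_lim P_lim r by (auto intro: LIMSEQ_subseq_LIMSEQ)
  have P': "P' \<in> stiefel"
    using P P_lim compact_imp_closed[OF compact_stiefel] closed_sequentially by metis
  obtain S' where svd': "thin_svd H' U' S' V'"
    using thin_svd_limit[of "H \<circ> r" "U \<circ> r" "S \<circ> r" "V \<circ> r", OF _ Hr U V] svd by auto
  have UV: "(\<lambda>i. U (r i) ** transpose (V (r i))) \<longlonglongrightarrow> U' ** transpose V'"
    using tendsto_matrix_mult[OF U tendsto_transpose[OF V]] by (simp add: o_def)
  have "(\<lambda>i. inner (U (r i) ** transpose (V (r i))) (H (r i)) - inner (P (r i)) (H (r i)))
      \<longlonglongrightarrow> inner (U' ** transpose V') H' - inner P' H'"
    using UV Hr Pr by (intro tendsto_intros) (simp_all add: o_def)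
  moreover have "(\<lambda>i. inner (U (r i) ** transpose (V (r i))) (H (r i)) - inner (P (r i)) (H (r i))) \<longlonglongrightarrow> 0"
    using LIMSEQ_subseq_LIMSEQ[OF gap r] by (simp add: o_def)
  ultimately have "inner (U' ** transpose V') H' - inner P' H' = 0"
    using LIMSEQ_unique by blast
  then have "P' = U' ** transpose V'"
    using polar_factor_unique_maximizer[OF svd' P' rank] by simp
  then show ?thesis using UV r by auto
qed

subsection \<open>Isolated accumulation points\<close>

text \<open>After any member of \<open>A\<close> there is a later non-member; without an exit in
  between, induction would keep all later indices in \<open>A\<close>.\<close>

lemma infinite_upcrossings:
  fixes A :: "nat set"
  assumes "infinite A" and "infinite (- A)"
  shows "infinite {i. i \<in> A \<and> Suc i \<notin> A}"
  unfolding infinite_nat_iff_unbounded_le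
proof
  fix m
  obtain i where i: "i \<ge> m" "i \<in> A"
    using assms(1) unfolding infinite_nat_iff_unbounded_le by blast
  obtain j where j: "j \<ge> i" "j \<notin> A"
    using assms(2) unfolding infinite_nat_iff_unbounded_le by auto
  have "\<exists>k. k \<ge> i \<and> k \<in> A \<and> Suc k \<notin> A"
  proof (rule ccontr)
    assume *: "\<not> ?thesis"
    have "j \<in> A" using j(1)
      by (induction rule: dec_induct) (use i * in auto)
    with j show False by simp
  qed
  then show "\<exists>n\<ge>m. n \<in> {i. i \<in> A \<and> Suc i \<notin> A}"
    using i order_trans by blast
qed

text \<open>If \<open>G\<close> did not tend to 0, the sequence would cross a small level \<open>e\<close> upwards infinitely
  often. By isolation a limit of its positions before the crossings is a zero of \<open>G\<close>, whereas
  the next iterates keep \<open>G \<ge> e\<close>.\<close>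

lemma isolated_zero_imp_tendsto:
  fixes x :: "nat \<Rightarrow> 'a::metric_space" and G :: "'a \<Rightarrow> real"
  assumes "compact K" and x: "\<And>i. x i \<in> K" and cont: "continuous_on K G"
    and nonneg: "\<And>y. y \<in> K \<Longrightarrow> G y \<ge> 0"
    and "\<epsilon> > 0"
    and isolated: "\<And>r y. strict_mono r \<Longrightarrow> (x \<circ> r) \<longlonglongrightarrow> y \<Longrightarrow> y \<in> K \<Longrightarrow> G y < \<epsilon> \<Longrightarrow> G y = 0"
    and step: "\<And>r y. strict_mono r \<Longrightarrow> (x \<circ> r) \<longlonglongrightarrow> y \<Longrightarrow> y \<in> K \<Longrightarrow> G y = 0 \<Longrightarrow>
      \<exists>s z. strict_mono s \<and> z \<in> K \<and> (\<lambda>i. x (Suc (r (s i)))) \<longlonglongrightarrow> z \<and> G z = 0"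
    and acc: "strict_mono r0" "(x \<circ> r0) \<longlonglongrightarrow> y0" "y0 \<in> K" "G y0 = 0"
  shows "(\<lambda>i. G (x i)) \<longlonglongrightarrow> 0"
proof (rule ccontr)
  assume "\<not> ?thesis"
  then obtain e' where e': "e' > 0" "\<And>N. \<exists>i\<ge>N. G (x i) \<ge> e'"
    using nonneg[OF x] by (auto simp: LIMSEQ_iff not_less)
  \<comment> \<open>The level is strictly below \<open>\<epsilon>\<close>, so that a limit with
    \<open>G y \<le> e\<close> still falls under the isolation hypothesis.\<close>
  define e where "e = min e' (\<epsilon> / 2)"
  have e: "e > 0" "e < \<epsilon>" "\<And>N. \<exists>i\<ge>N. G (x i) \<ge> e"
    using e' \<open>\<epsilon> > 0\<close> by (auto simp: e_def min_le_iff_disj) 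
  have Glim: "(\<lambda>i. G (y i)) \<longlonglongrightarrow> G z" if "\<And>i. y i \<in> K" "z \<in> K" "y \<longlonglongrightarrow> z" for y z
    using continuous_on_tendsto_compose[OF cont that(3,2)] that(1) by simp
  define A where "A = {i. G (x i) < e}"
  have "infinite A"
    unfolding infinite_nat_iff_unbounded_le
  proof
    fix m
    have "(\<lambda>i. G ((x \<circ> r0) i)) \<longlonglongrightarrow> 0"
      using Glim[of "x \<circ> r0" y0] acc x by simp
    then obtain N where "\<And>i. i \<ge> N \<Longrightarrow> G (x (r0 i)) < e"
      using order_tendstoD(2)[of "\<lambda>i. G ((x \<circ> r0) i)" 0 sequentially e] e(1)
      unfolding eventually_sequentially by auto
    then have "G (x (r0 (max N m))) < e" by simp
    moreover have "r0 (max N m) \<ge> m"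
      using seq_suble[OF acc(1), of "max N m"] by linarith
    ultimately show "\<exists>n\<ge>m. n \<in> A" by (auto simp: A_def)
  qed
  moreover have "infinite (- A)"
    using e(3) unfolding infinite_nat_iff_unbounded_le by (auto simp: A_def not_less)
  ultimately obtain r1 :: "nat \<Rightarrow> nat" where r1: "strict_mono r1" "\<And>i. r1 i \<in> A \<and> Suc (r1 i) \<notin> A"
    using infinite_enumerate[OF infinite_upcrossings] by blast
  obtain y and r2 :: "nat \<Rightarrow> nat"
    where y: "y \<in> K" "strict_mono r2" "((x \<circ> r1) \<circ> r2) \<longlonglongrightarrow> y"
    using compact_subseqE[OF \<open>compact K\<close>, of "x \<circ> r1"] x by auto
  define r where "r = r1 \<circ> r2"
  have r: "strict_mono r" "(x \<circ> r) \<longlonglongrightarrow> y" "\<And>i. r i \<in> A" "\<And>i. Suc (r i) \<notin> A"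
    using r1 y by (auto simp: r_def o_assoc strict_mono_o)
  have "(\<lambda>i. G ((x \<circ> r) i)) \<longlonglongrightarrow> G y"
    using Glim[of "x \<circ> r" y] r y x by simp
  then have "G y \<le> e"
    using r(3) by (intro LIMSEQ_le_const2) (auto simp: A_def intro: less_imp_le)
  then have "G y = 0"
    using isolated[OF r(1,2) y(1)] e by simp
  then obtain s z where s: "strict_mono s" "z \<in> K" "(\<lambda>i. x (Suc (r (s i)))) \<longlonglongrightarrow> z" "G z = 0"
    using step[OF r(1,2) y(1)] by auto
  have "(\<lambda>i. G (x (Suc (r (s i))))) \<longlonglongrightarrow> G z"
    using Glim[OF _ s(2,3)] x by simp
  then have "e \<le> G z"
    using r(4) by (intro LIMSEQ_le_const) (auto simp: A_def not_less)
  with s(4) e(1) show False by simp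
qed

lemma accumulation_point_in_UNIV_dist:
  "accumulation_point_in UNIV dist x l \<longleftrightarrow> (\<exists>r. strict_mono r \<and> (x \<circ> r) \<longlonglongrightarrow> l)"
  unfolding accumulation_point_in_def converges_in_def
  by (subst tendsto_dist_iff) simp

subsection \<open>The NPDo iteration\<close>

text \<open>Since the gap vanishes and the gradient at \<open>X\<close> has full rank, the polar
  factors tend to \<open>X\<close> along a subsequence; compactness then provides a limit of the
  factors \<open>Q\<close>. That limit is exposed because (c1) has to identify it.\<close>

lemma npdo_scf_step_convergent:
  fixes f :: "real^'k^'n \<Rightarrow> real" and P U :: "nat \<Rightarrow> real^'k^'n" and S V Q :: "nat \<Rightarrow> real^'k^'k"
  assumes svd: "\<And>i. thin_svd (euclidean_gradient f (P i)) (U i) (S i) (V i)"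
    and P: "\<And>i. P i \<in> stiefel" and Q: "\<And>i. Q i \<in> stiefel"
    and step: "\<And>i. P (Suc i) = U i ** transpose (V i) ** Q i"
    and gap: "(\<lambda>i. inner (U i ** transpose (V i)) (euclidean_gradient f (P i))
        - inner (P i) (euclidean_gradient f (P i))) \<longlonglongrightarrow> 0"
    and cont: "continuous_on stiefel (euclidean_gradient f)"
    and r: "strict_mono r" and lim: "(P \<circ> r) \<longlonglongrightarrow> X" and X: "X \<in> stiefel"
    and rank: "rank (euclidean_gradient f X) = CARD('k)"
  shows "\<exists>s R. strict_mono s \<and> R \<in> stiefel \<and> (\<lambda>i. Q (r (s i))) \<longlonglongrightarrow> R
    \<and> (\<lambda>i. P (Suc (r (s i)))) \<longlonglongrightarrow> X ** R"
proof -
  have "(\<lambda>i. euclidean_gradient f ((P \<circ> r) i)) \<longlonglongrightarrow> euclidean_gradient f X"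
    using continuous_on_tendsto_compose[OF cont lim X] P by simp
  then obtain s where s: "strict_mono s" "(\<lambda>i. U (r (s i)) ** transpose (V (r (s i)))) \<longlonglongrightarrow> X"
    using polar_factors_converge[of "\<lambda>i. euclidean_gradient f (P (r i))" "U \<circ> r" "S \<circ> r" "V \<circ> r"
        "P \<circ> r" "euclidean_gradient f X" X] svd P lim rank LIMSEQ_subseq_LIMSEQ[OF gap r]
    by (auto simp: o_def)
  obtain R and t :: "nat \<Rightarrow> nat"
    where t: "R \<in> stiefel" "strict_mono t" "((\<lambda>i. Q (r (s i))) \<circ> t) \<longlonglongrightarrow> R"
    by (rule compact_subseqE[OF compact_stiefel Q])
  have "(\<lambda>i. P (Suc (r (s (t i))))) \<longlonglongrightarrow> X ** R"
    unfolding step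
    using tendsto_matrix_mult[OF LIMSEQ_subseq_LIMSEQ[OF s(2) t(2)] t(3)] by (simp add: o_def)
  then show ?thesis
    using s(1) t by (intro exI[of _ "s \<circ> t"] exI[of _ R]) (auto simp: o_def strict_mono_def)
qed

text \<open>Continuity of the gradient is a premise of (b) and (c), where it carries convergence of
  the iterates over to their gradients.\<close>

theorem theorem3p3:
  fixes f :: "real^'k^'n \<Rightarrow> real"
    and N :: "real^'k^'k \<Rightarrow> real"
    and \<delta> \<omega> :: real
    and \<P> :: "(real^'k^'n) set"
    and P :: "nat \<Rightarrow> real^'k^'n"
    and Q :: "nat \<Rightarrow> real^'k^'k"
    and Pstar :: "real^'k^'n"
  assumes "CARD('k) \<le> CARD('n)"
    and "is_norm N" and "\<delta> > 0"
    and "f differentiable_on stiefel_nhd N \<delta>"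
    and "\<P> \<subseteq> stiefel"
    and "npdo_ansatz f \<P> \<omega>"
    and "npdo_scf f \<P> \<omega> P Q"
    and "accumulation_point_in UNIV dist P Pstar"
  shows
    "accumulation_point_in (grassmannian TYPE('k)) (dist2 TYPE('k))
       (\<lambda>i. column_space (P i)) (column_space Pstar)
     \<and>
     (continuous_on stiefel (euclidean_gradient f) \<longrightarrow>
      isolated_accumulation_point_in (grassmannian TYPE('k)) (dist2 TYPE('k))
        (\<lambda>i. column_space (P i)) (column_space Pstar) \<longrightarrow>
      (\<forall>R::real^'k^'k. R \<in> stiefel \<longrightarrow>
        rank (euclidean_gradient f (Pstar ** R)) = CARD('k)) \<longrightarrow>
      converges_in (grassmannian TYPE('k)) (dist2 TYPE('k))
        (\<lambda>i. column_space (P i)) (column_space Pstar))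
     \<and>
     (continuous_on stiefel (euclidean_gradient f) \<longrightarrow>
      isolated_accumulation_point_in UNIV dist P Pstar \<longrightarrow>
      rank (euclidean_gradient f Pstar) = CARD('k) \<longrightarrow>
      (Q \<longlonglongrightarrow> mat 1 \<or>
       (\<forall>R\<in>stiefel. R \<noteq> Pstar \<and> column_space R = column_space Pstar \<longrightarrow> f Pstar > f R)) \<longrightarrow>
      P \<longlonglongrightarrow> Pstar)"
proof -
  obtain U S V where alg: "\<And>i. thin_svd (euclidean_gradient f (P i)) (U i) (S i) (V i)"
      "\<And>i. Q i \<in> stiefel" "\<And>i. P (Suc i) = U i ** transpose (V i) ** Q i"
      "\<And>i. P (Suc i) \<in> \<P>"
      "\<And>i. f (P (Suc i)) \<ge> f (P i) +
        \<omega> * (inner (U i ** transpose (V i)) (euclidean_gradient f (P i))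
            - inner (P i) (euclidean_gradient f (P i)))"
    using assms(7) unfolding npdo_scf_def Let_def trace_transpose_mult_eq_inner by metis
  have P: "P i \<in> stiefel" for i
    using alg(4) assms(5,7) by (cases i) (auto simp: npdo_scf_def)
  have "\<omega> > 0" using assms(6) by (simp add: npdo_ansatz_def)
  obtain r0 where r0: "strict_mono r0" "(P \<circ> r0) \<longlonglongrightarrow> Pstar"
    using assms(8) unfolding accumulation_point_in_UNIV_dist by blast
  have Pstar: "Pstar \<in> stiefel"
    using closed_sequentially[OF compact_imp_closed[OF compact_stiefel] _ r0(2)] P by simp

  have a: "accumulation_point_in (grassmannian TYPE('k)) (dist2 TYPE('k))
       (\<lambda>i. column_space (P i)) (column_space X)"
    if "strict_mono r" "(P \<circ> r) \<longlonglongrightarrow> X" "X \<in> stiefel" for r X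
    using converges_in_column_space[OF _ that(3,2)] P that(1)
    by (auto simp: accumulation_point_in_def o_def)

  \<comment> \<open>On the Stiefel manifold the argument of \<open>N\<close> is 0, so the manifold
    lies in the neighborhood where \<open>f\<close> is differentiable.\<close>
  have "N 0 = 0" using assms(2) unfolding is_norm_def by blast
  then have "stiefel \<subseteq> stiefel_nhd N \<delta>"
    using assms(3) by (auto simp: stiefel_def stiefel_nhd_def)
  then have f_cont: "continuous_on stiefel f"
    using assms(4) differentiable_imp_continuous_on continuous_on_subset by blast
  define \<eta> where "\<eta> i = inner (U i ** transpose (V i)) (euclidean_gradient f (P i))
    - inner (P i) (euclidean_gradient f (P i))" for i
  have \<eta>: "0 \<le> \<eta> i" "\<omega> * \<eta> i \<le> f (P (Suc i)) - f (P i)" for i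
    using inner_le_polar_factor[OF alg(1) P, of i i] alg(5)[of i] by (auto simp: \<eta>_def)
  have "incseq (\<lambda>i. f (P i))"
    using \<eta> \<open>\<omega> > 0\<close> by (intro incseq_SucI) (smt (verit) mult_nonneg_nonneg)
  moreover have "bounded (f ` stiefel)"
    by (intro compact_imp_bounded compact_continuous_image f_cont compact_stiefel)
  then have "bdd_above (f ` stiefel)"
    by (rule bounded_imp_bdd_above)
  then obtain B where "\<And>i. f (P i) \<le> B"
    using P by (auto simp: bdd_above_def)
  ultimately obtain L where L: "(\<lambda>i. f (P i)) \<longlonglongrightarrow> L"
    by (metis incseq_convergent)
  \<comment> \<open>Squeezed between 0 and the increments of the convergent sequence of values of
    \<open>f\<close>.\<close>
  have "(\<lambda>i. \<omega> * \<eta> i) \<longlonglongrightarrow> 0"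
  proof (rule tendsto_sandwich)
    show "(\<lambda>i. 0 :: real) \<longlonglongrightarrow> 0" by simp
    show "(\<lambda>i. f (P (Suc i)) - f (P i)) \<longlonglongrightarrow> 0"
      using tendsto_diff[OF LIMSEQ_Suc[OF L] L] by simp
  qed (use \<eta> \<open>\<omega> > 0\<close> in auto)
  then have gap: "\<eta> \<longlonglongrightarrow> 0"
    using \<open>\<omega> > 0\<close> tendsto_mult_left[of "\<lambda>i. \<omega> * \<eta> i" 0 sequentially "inverse \<omega>"]
    by (simp add: field_simps)
  note step = npdo_scf_step_convergent[OF alg(1) P alg(2,3) gap[unfolded \<eta>_def]]

  show ?thesis
  proof (intro conjI impI)
    show "accumulation_point_in (grassmannian TYPE('k)) (dist2 TYPE('k))
       (\<lambda>i. column_space (P i)) (column_space Pstar)"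
      using a r0 Pstar by blast
  next
    assume cont: "continuous_on stiefel (euclidean_gradient f)"
      and iso: "isolated_accumulation_point_in (grassmannian TYPE('k)) (dist2 TYPE('k))
        (\<lambda>i. column_space (P i)) (column_space Pstar)"
      and rank: "\<forall>R::real^'k^'k. R \<in> stiefel \<longrightarrow>
        rank (euclidean_gradient f (Pstar ** R)) = CARD('k)"
    obtain \<epsilon> where \<epsilon>: "\<epsilon> > 0" "\<And>l. accumulation_point_in (grassmannian TYPE('k)) (dist2 TYPE('k))
        (\<lambda>i. column_space (P i)) l \<Longrightarrow> dist2 TYPE('k) l (column_space Pstar) < \<epsilon> \<Longrightarrow> l = column_space Pstar"
      using iso by (auto simp: isolated_accumulation_point_in_def)
    \<comment> \<open>On the Stiefel manifold the zeros of \<open>G\<close> form the whole orbit of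
      \<open>Pstar\<close>, and one step from near the orbit may end near another of its
      points.\<close>
    define G where "G X = dist2 TYPE('k) (column_space X) (column_space Pstar)" for X :: "real^'k^'n"
    have G0: "G X = 0 \<longleftrightarrow> column_space X = column_space Pstar" if "X \<in> stiefel" for X
      unfolding G_def by (rule dist2_eq_0_iff[OF that Pstar])
    have G_nonneg: "G X \<ge> 0" if "X \<in> stiefel" for X
      unfolding G_def by (rule dist2_nonneg[OF that Pstar])
    have "(\<lambda>i. G (P i)) \<longlonglongrightarrow> 0"
    proof (rule isolated_zero_imp_tendsto[OF compact_stiefel, of P G \<epsilon> r0 Pstar])
      show "continuous_on stiefel G"
        unfolding continuous_on_sequentially G_def o_def
        using Pstar by (auto intro!: tendsto_dist2)
      show "G X = 0" if "strict_mono r" "(P \<circ> r) \<longlonglongrightarrow> X" "X \<in> stiefel" "G X < \<epsilon>" for r X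
        unfolding G0[OF that(3)]
        by (rule \<epsilon>(2)[OF a[OF that(1-3)] that(4)[unfolded G_def]])
      show "\<exists>s Z. strict_mono s \<and> Z \<in> stiefel \<and> (\<lambda>i. P (Suc (r (s i)))) \<longlonglongrightarrow> Z \<and> G Z = 0"
        if r: "strict_mono r" and lim: "(P \<circ> r) \<longlonglongrightarrow> X" and X: "X \<in> stiefel" and "G X = 0" for r X
      proof -
        have eq: "column_space X = column_space Pstar" using G0[OF X] \<open>G X = 0\<close> by simp
        \<comment> \<open>\<open>X\<close> is \<open>Pstar\<close> times an orthogonal matrix, so
          the rank assumption on the orbit applies.\<close>
        then have "rank (euclidean_gradient f X) = CARD('k)"
          using column_space_subset_imp_eq_mult[OF Pstar X] rank by (metis order_refl)
        then obtain s R where sR: "strict_mono s" "R \<in> stiefel" "(\<lambda>i. P (Suc (r (s i)))) \<longlonglongrightarrow> X ** R"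
          using step[OF cont r lim X] by blast
        moreover have "X ** R \<in> stiefel"
          by (rule stiefel_mult[OF X sR(2)])
        moreover have "G (X ** R) = 0"
          using G0[OF \<open>X ** R \<in> stiefel\<close>] eq sR(2) by (simp add: column_space_mult)
        ultimately show ?thesis by blast
      qed
    qed (use P Pstar r0 \<epsilon>(1) G0 G_nonneg in simp_all)
    then show "converges_in (grassmannian TYPE('k)) (dist2 TYPE('k))
        (\<lambda>i. column_space (P i)) (column_space Pstar)"
      using column_space_in_grassmannian[OF Pstar] by (simp add: converges_in_def G_def)
  next
    assume cont: "continuous_on stiefel (euclidean_gradient f)"
      and iso: "isolated_accumulation_point_in UNIV dist P Pstar"
      and rank: "rank (euclidean_gradient f Pstar) = CARD('k)"
      and c: "Q \<longlonglongrightarrow> mat 1 \<or>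
       (\<forall>R\<in>stiefel. R \<noteq> Pstar \<and> column_space R = column_space Pstar \<longrightarrow> f Pstar > f R)"
    obtain \<epsilon> where \<epsilon>: "\<epsilon> > 0"
        "\<And>l. accumulation_point_in UNIV dist P l \<Longrightarrow> dist l Pstar < \<epsilon> \<Longrightarrow> l = Pstar"
      using iso by (auto simp: isolated_accumulation_point_in_def)
    \<comment> \<open>All accumulation points share the objective value \<open>L\<close>; (c2) turns
      this into uniqueness within the orbit.\<close>
    have f_lim: "f X = L" if "strict_mono r" "(\<lambda>i. P (r i)) \<longlonglongrightarrow> X" "X \<in> stiefel" for r X
    proof -
      have "(\<lambda>i. f (P (r i))) \<longlonglongrightarrow> f X"
        using continuous_on_tendsto_compose[OF f_cont that(2,3)] P by simp
      moreover have "(\<lambda>i. f (P (r i))) \<longlonglongrightarrow> L"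
        using LIMSEQ_subseq_LIMSEQ[OF L that(1)] by (simp add: o_def)
      ultimately show ?thesis by (rule LIMSEQ_unique)
    qed
    have "(\<lambda>i. dist (P i) Pstar) \<longlonglongrightarrow> 0"
    proof (rule isolated_zero_imp_tendsto[OF compact_stiefel, of P "\<lambda>X. dist X Pstar" \<epsilon> r0 Pstar])
      show "continuous_on stiefel (\<lambda>X. dist X Pstar)"
        by (intro continuous_intros)
      show "dist X Pstar = 0" if "strict_mono r" "(P \<circ> r) \<longlonglongrightarrow> X" "dist X Pstar < \<epsilon>" for r X
        using \<epsilon>(2)[of X] that unfolding accumulation_point_in_UNIV_dist by auto
      show "\<exists>s Z. strict_mono s \<and> Z \<in> stiefel \<and> (\<lambda>i. P (Suc (r (s i)))) \<longlonglongrightarrow> Z \<and> dist Z Pstar = 0"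
        if r: "strict_mono r" and "(P \<circ> r) \<longlonglongrightarrow> X" "dist X Pstar = 0" for r X
      proof -
        have lim: "(P \<circ> r) \<longlonglongrightarrow> Pstar" using that by simp
        obtain s R where sR: "strict_mono s" "R \<in> stiefel" "(\<lambda>i. Q (r (s i))) \<longlonglongrightarrow> R"
            "(\<lambda>i. P (Suc (r (s i)))) \<longlonglongrightarrow> Pstar ** R"
          using step[OF cont r lim Pstar rank] by blast
        have "Pstar ** R = Pstar"
          using c
        proof
          assume "Q \<longlonglongrightarrow> mat 1"
          then have "(Q \<circ> (r \<circ> s)) \<longlonglongrightarrow> mat 1"
            using r sR(1) by (intro LIMSEQ_subseq_LIMSEQ strict_mono_o)
          then have "R = mat 1"
            using sR(3) by (simp add: o_def LIMSEQ_unique)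
          then show ?thesis by simp
        next
          assume max: "\<forall>R\<in>stiefel. R \<noteq> Pstar \<and> column_space R = column_space Pstar \<longrightarrow> f Pstar > f R"
          \<comment> \<open>The shifted indices also form a subsequence, so
            \<open>Pstar ** R\<close> is an accumulation point with the same value of
            \<open>f\<close> as \<open>Pstar\<close>.\<close>
          have "strict_mono (\<lambda>i. Suc (r (s i)))"
            using r sR(1) by (simp add: strict_mono_def)
          then have "f (Pstar ** R) = f Pstar"
            using f_lim[OF _ sR(4) stiefel_mult[OF Pstar sR(2)]] f_lim[of r0 Pstar] r0 Pstar
            by (simp add: o_def)
          then show ?thesis
            using max stiefel_mult[OF Pstar sR(2)] column_space_mult[OF sR(2)] by force
        qed
        then show ?thesis using sR Pstar by auto
      qed
    qed (use P Pstar r0 \<epsilon>(1) in simp_all)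
    then show "P \<longlonglongrightarrow> Pstar"
      by (subst tendsto_dist_iff)
  qed
qed

end
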